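(* $\mathscr{H}^2_0\odot\mathscr{H}^2_0 \subsetneq \partial^{-1}\left(\mathscr{H}^2_0\odot\partial\mathscr{H}^2_0\right)$, i.e. $\mathscr{H}^2_0\odot\mathscr{H}^2_0$ is contained in, and not equal to, $\partial^{-1}\left(\mathscr{H}^2_0\odot\partial\mathscr{H}^2_0\right)$.
   Context: $\mathscr{H}^2$ is the Hilbert space of Dirichlet series $f(s)=\sum_{n\ge1}a_nn^{-s}$ with $\|f\|_{\mathscr{H}^2}=(\sum_{n\ge1}|a_n|^2)^{1/2}<\infty$; $\mathscr{H}^2_0$ is its subspace of series with $a_1=f(+\infty)=0$; $f'$ denotes the derivative $f'(s)=-\sum_{n\ge2}a_n(\log n)n^{-s}$. The weak product $\mathscr{H}^2_0\odot\mathscr{H}^2_0$ is the Banach space completion of the finite sums $F=\sum_kf_kg_k$, $f_k,g_k\in\mathscr{H}^2_0$, under the norm $\inf\sum_k\|f_k\|_{\mathscr{H}^2}\|g_k\|_{\mathscr{H}^2}$, the infimum being over all finite representations of $F$. The skew product $\partial^{-1}(\mathscr{H}^2_0\odot\partial\mathscr{H}^2_0)$ is the Banach space completion of the space of Dirichlet series $F$ with constant term $F(+\infty)=0$ whose derivatives have a finite sum representation $F'=\sum_kf_kg_k'$ with $f_k,g_k\in\mathscr{H}^2_0$, under the norm $\inf\sum_k\|f_k\|_{\mathscr{H}^2}\|g_k\|_{\mathscr{H}^2}$, the infimum being over all finite representations. Both are regarded as spaces of Dirichlet series. *)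

theory Defs
  imports "HOL-Analysis.Analysis"
begin

text \<open>A Dirichlet series with coefficients \<open>a n\<close>, \<open>n \<ge> 1\<close>, is identified with its coefficient
  function. The index \<open>0\<close> is unused and fixed to have value \<open>0\<close>, so that equality of Dirichlet
  series is equality of functions.\<close>

type_synonym dseries = "nat \<Rightarrow> complex"

definition dmult :: "dseries \<Rightarrow> dseries \<Rightarrow> dseries" where
  "dmult a b n = (if n = 0 then 0 else (\<Sum>d | d dvd n. a d * b (n div d)))"

definition dderiv :: "dseries \<Rightarrow> dseries" where
  "dderiv a n = - (complex_of_real (ln (real n)) * a n)"

definition H2 :: "dseries set" where
  "H2 = {a. a 0 = 0 \<and> summable (\<lambda>n. (cmod (a n))\<^sup>2)}"

definition H2_norm :: "dseries \<Rightarrow> real" where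
  "H2_norm a = sqrt (\<Sum>n. (cmod (a n))\<^sup>2)"

definition H2_0 :: "dseries set" where
  "H2_0 = {a \<in> H2. a 1 = 0}"

definition rep_cost :: "(dseries \<times> dseries) list \<Rightarrow> real" where
  "rep_cost ps = (\<Sum>(f, g)\<leftarrow>ps. H2_norm f * H2_norm g)"


definition weak_reps :: "dseries \<Rightarrow> (dseries \<times> dseries) list set" where
  "weak_reps F = {ps. set ps \<subseteq> H2_0 \<times> H2_0 \<and> F = (\<lambda>n. \<Sum>(f, g)\<leftarrow>ps. dmult f g n)}"

definition weak_finite :: "dseries set" where
  "weak_finite = {F. weak_reps F \<noteq> {}}"

definition weak_norm :: "dseries \<Rightarrow> real" where
  "weak_norm F = (INF ps\<in>weak_reps F. rep_cost ps)"


definition skew_reps :: "dseries \<Rightarrow> (dseries \<times> dseries) list set" where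
  "skew_reps F = {ps. set ps \<subseteq> H2_0 \<times> H2_0 \<and>
                      dderiv F = (\<lambda>n. \<Sum>(f, g)\<leftarrow>ps. dmult f (dderiv g) n)}"

definition skew_finite :: "dseries set" where
  "skew_finite = {F. F 0 = 0 \<and> F 1 = 0 \<and> skew_reps F \<noteq> {}}"

definition skew_norm :: "dseries \<Rightarrow> real" where
  "skew_norm F = (INF ps\<in>skew_reps F. rep_cost ps)"


text \<open>The Banach space completion of a space \<open>V\<close> of Dirichlet series under a norm \<open>N\<close>, regarded as
  a space of Dirichlet series: the class of a Cauchy sequence is the Dirichlet series whose
  coefficients are the limits of the coefficients.

  For the two norms above this is a faithful realization of the abstract completion. Coefficients
  are bounded functionals by the Cauchy--Schwarz inequality (for the skew norm, after dividing by
  \<open>log n\<close>), so the limits exist and depend only on the class. The class is determined by the limits: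
  if all coefficients of a Cauchy sequence tend to \<open>0\<close>, then so do the norms. To see this, apply the
  maps \<open>a n \<mapsto> r n * a n\<close> with \<open>r\<close> completely multiplicative, \<open>0 \<le> r \<le> 1\<close>, supported on the integers
  composed of finitely many primes, and less than \<open>1\<close> at those primes. They are contractions for
  both norms, converge strongly to the identity as \<open>r\<close> increases to \<open>1\<close>, and each of them is a norm
  limit of maps that depend on finitely many coefficients only.\<close>

definition ds_completion :: "dseries set \<Rightarrow> (dseries \<Rightarrow> real) \<Rightarrow> dseries set" where
  "ds_completion V N = {F. \<exists>X :: nat \<Rightarrow> dseries.
      (\<forall>j. X j \<in> V) \<and>
      (\<forall>e>0. \<exists>M. \<forall>i\<ge>M. \<forall>j\<ge>M. N (\<lambda>n. X i n - X j n) < e) \<and>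
      (\<forall>n. (\<lambda>j. X j n) \<longlonglongrightarrow> F n)}"

definition weak_product :: "dseries set" where
  "weak_product = ds_completion weak_finite weak_norm"

definition skew_product :: "dseries set" where
  "skew_product = ds_completion skew_finite skew_norm"

end

theory Submission
  imports Defs "HOL-Computational_Algebra.Primes"
begin

text \<open>The product rule \<open>(f g)' = f g' + g f'\<close> gives the inclusion, with norm at most \<open>2\<close>. It is strict
  already on coefficients at products \<open>p i * q j\<close> of two primes, where the weak product carries a
  trace norm and the skew product inserts the Schur multiplier
  \<open>log (q j) / (log (p i) + log (q j))\<close>. For interleaved, doubly exponentially growing primes
  \<open>p 0 < q 0 < p 1 < q 1 < \<dots>\<close> this multiplier behaves like triangular truncation, which is unbounded:
  the Hilbert matrix \<open>1 / (j - i)\<close> defines a bounded form on the weak product, but its truncation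
  to \<open>i < j\<close> diverges on \<open>a i * a j\<close> for a suitable square summable sequence \<open>a\<close>.
  So the primitive \<open>F\<close> of \<open>f g'\<close> with \<open>f = \<Sum>i. a i * (p i) powr - s\<close> and
  \<open>g = \<Sum>j. a j * (q j) powr - s\<close> is not in the weak product.\<close>

section \<open>Hilbert's inequality by Fourier integrals\<close>

lemma integral_cis:
  fixes m :: int
  shows "((\<lambda>t. cis (of_int m * t)) has_integral (if m = 0 then 2 * pi else 0)) {0..2*pi}"
proof (cases "m = 0")
  case True
  then show ?thesis
    using has_integral_const_real[of "1::complex" 0 "2*pi"] by (simp add: scaleR_conv_of_real)
next
  case False
  have "((\<lambda>t. cis (of_int m * t)) has_integral
      (cis (of_int m * (2*pi)) / (\<i> * of_int m) - cis (of_int m * 0) / (\<i> * of_int m))) {0..2*pi}"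
    by (rule fundamental_theorem_of_calculus)
      (auto intro!: derivative_eq_intros simp: has_vector_derivative_def False scaleR_conv_of_real
         field_simps)
  moreover have "cis (of_int m * (2*pi)) = 1"
    using cis_multiple_2pi[of "of_int m"] by (simp add: mult_ac)
  ultimately show ?thesis using False by simp
qed

text \<open>For \<open>m = 0\<close> the right-hand side is \<open>x / 0 = 0\<close>, which is the correct value. This is why the sums over
  \<open>1 / (j - i)\<close> below may include the diagonal.\<close>

lemma integral_sawtooth_cis:
  fixes m :: int
  shows "((\<lambda>t. of_real (t - pi) * cis (of_int m * t)) has_integral
    (2 * pi / (\<i> * of_int m))) {0..2*pi}"
proof (cases "m = 0")
  case True
  have "((\<lambda>t. complex_of_real (t - pi)) has_integral
      (complex_of_real ((2*pi)^2/2 - pi * (2*pi)) - complex_of_real (0^2/2 - pi * 0))) {0..2*pi}"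
    by (rule fundamental_theorem_of_calculus)
      (auto intro!: derivative_eq_intros simp: has_vector_derivative_def scaleR_conv_of_real
         field_simps)
  then show ?thesis using True by (simp add: power2_eq_square)
next
  case False
  \<comment> \<open>Integration by parts; the second term is
    \<open>- cis / (\<i> * m)^2\<close>.\<close>
  let ?F = "\<lambda>t. of_real (t - pi) * cis (of_int m * t) / (\<i> * of_int m) + cis (of_int m * t) / (of_int m)^2"
  have "((\<lambda>t. of_real (t - pi) * cis (of_int m * t)) has_integral (?F (2*pi) - ?F 0)) {0..2*pi}"
    by (rule fundamental_theorem_of_calculus)
      (auto intro!: derivative_eq_intros simp: has_vector_derivative_def False scaleR_conv_of_real
         field_simps power2_eq_square)
  moreover have "cis (of_int m * (2*pi)) = 1"
    using cis_multiple_2pi[of "of_int m"] by (simp add: mult_ac)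
  moreover have "?F (2*pi) - ?F 0 = 2 * pi / (\<i> * of_int m)"
    using False calculation(2) by (simp add: divide_simps)
  ultimately show ?thesis by simp
qed

text \<open>Parseval: distinct frequencies are orthogonal on a period. The factor \<open>s\<close>
  lets one identity serve both the frequencies \<open>- i\<close> and the frequencies
  \<open>j\<close>.\<close>

lemma integral_trig_poly_norm_square:
  fixes x :: "nat \<Rightarrow> complex" and s :: int
  assumes "s \<noteq> 0"
  shows "((\<lambda>t. (cmod (\<Sum>i<N. x i * cis (of_int (s * int i) * t)))\<^sup>2) has_integral
    (2 * pi * (\<Sum>i<N. (cmod (x i))\<^sup>2))) {0..2*pi}"
proof -
  have cis: "cis (of_int (s * int i - s * int k) * t)
      = cis (of_int (s * int i) * t) * cnj (cis (of_int (s * int k) * t))" for i k t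
    by (simp add: cis_cnj cis_mult algebra_simps)
  have "((\<lambda>t. \<Sum>i<N. \<Sum>k<N. (x i * cnj (x k)) * cis (of_int (s * int i - s * int k) * t)) has_integral
       (\<Sum>i<N. \<Sum>k<N. (x i * cnj (x k)) * (if s * int i - s * int k = 0 then 2*pi else 0))) {0..2*pi}"
    by (intro has_integral_sum has_integral_mult_right integral_cis) auto
  also have "(\<Sum>i<N. \<Sum>k<N. (x i * cnj (x k)) * complex_of_real (if s * int i - s * int k = 0 then 2*pi else 0))
     = (\<Sum>i<N. \<Sum>k<N. if i = k then (x i * cnj (x k)) * (2*pi) else 0)"
    using assms by (intro sum.cong refl) auto
  also have "\<dots> = complex_of_real (2 * pi * (\<Sum>i<N. (cmod (x i))\<^sup>2))"
    by (simp add: sum_distrib_left complex_norm_square mult_ac del: of_real_power)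
  also have "(\<lambda>t. \<Sum>i<N. \<Sum>k<N. (x i * cnj (x k)) * cis (of_int (s * int i - s * int k) * t))
     = (\<lambda>t. complex_of_real ((cmod (\<Sum>i<N. x i * cis (of_int (s * int i) * t)))\<^sup>2))"
    unfolding complex_norm_square cnj_sum sum_product complex_cnj_mult cis
    by (intro ext sum.cong refl) (simp only: mult_ac)
  finally have "((\<lambda>t. complex_of_real ((cmod (\<Sum>i<N. x i * cis (of_int (s * int i) * t)))\<^sup>2))
      has_integral complex_of_real (2 * pi * (\<Sum>i<N. (cmod (x i))\<^sup>2))) {0..2*pi}" .
  from has_integral_linear[OF this bounded_linear_Re] show ?thesis
    by (simp only: o_def Re_complex_of_real)
qed

text \<open>Up to a constant, \<open>1 / (j - i)\<close> is a Fourier coefficient of the sawtooth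
  \<open>t - pi\<close>, so the double sum is an integral of \<open>(t - pi) * A t * B t\<close>.
  The sawtooth is at most \<open>pi\<close> in modulus, and Parseval finishes. Bounding
  \<open>|A| * |B|\<close> by half the sum of squares avoids Cauchy-Schwarz for integrals.\<close>

lemma hilbert_inequality_sum:
  fixes x y :: "nat \<Rightarrow> complex"
  shows "cmod (\<Sum>i<N. \<Sum>j<N. x i * y j / (of_nat j - of_nat i))
     \<le> pi / 2 * ((\<Sum>i<N. (cmod (x i))\<^sup>2) + (\<Sum>j<N. (cmod (y j))\<^sup>2))"
proof -
  \<comment> \<open>The frequencies of \<open>A\<close> are negated so that the product
    \<open>A t * B t\<close> has the frequencies \<open>j - i\<close>.\<close>
  define A where "A t = (\<Sum>i<N. x i * cis (of_int (-1 * int i) * t))" for t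
  define B where "B t = (\<Sum>j<N. y j * cis (of_int (1 * int j) * t))" for t
  define S where "S = (\<Sum>i<N. \<Sum>j<N. x i * y j / (of_nat j - of_nat i))"
  have AB: "A t * B t = (\<Sum>i<N. \<Sum>j<N. (x i * y j) * cis (of_int (int j - int i) * t))" for t
  proof -
    have "cis (- (real i * t)) * cis (real j * t) = cis ((real j - real i) * t)" for i j :: nat
      by (simp add: cis_mult algebra_simps)
    then show ?thesis
      unfolding A_def B_def sum_product by (intro sum.cong refl) (simp add: mult_ac del: cis_cnj)
  qed
  have "((\<lambda>t. \<Sum>i<N. \<Sum>j<N. (x i * y j) * (of_real (t - pi) * cis (of_int (int j - int i) * t)))
      has_integral (\<Sum>i<N. \<Sum>j<N. (x i * y j) * (2 * pi / (\<i> * of_int (int j - int i))))) {0..2*pi}"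
    by (intro has_integral_sum has_integral_mult_right integral_sawtooth_cis) auto
  also have "(\<lambda>t. \<Sum>i<N. \<Sum>j<N. (x i * y j) * (of_real (t - pi) * cis (of_int (int j - int i) * t)))
      = (\<lambda>t. of_real (t - pi) * (A t * B t))"
    unfolding AB sum_distrib_left by (intro ext sum.cong refl) simp
  also have "(\<Sum>i<N. \<Sum>j<N. (x i * y j) * (2 * pi / (\<i> * of_int (int j - int i)))) = 2 * pi / \<i> * S"
    unfolding S_def sum_distrib_left
    by (intro sum.cong refl) (simp add: mult_ac flip: divide_divide_eq_left)
  finally have I: "((\<lambda>t. of_real (t - pi) * (A t * B t)) has_integral (2 * pi / \<i> * S)) {0..2*pi}" .
  have J: "((\<lambda>t. pi / 2 * ((cmod (A t))\<^sup>2 + (cmod (B t))\<^sup>2)) has_integral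
      pi / 2 * (2 * pi * (\<Sum>i<N. (cmod (x i))\<^sup>2) + 2 * pi * (\<Sum>j<N. (cmod (y j))\<^sup>2))) {0..2*pi}"
    unfolding A_def B_def
    by (intro has_integral_mult_right has_integral_add integral_trig_poly_norm_square) auto
  have bound: "cmod (of_real (t - pi) * (A t * B t)) \<le> pi / 2 * ((cmod (A t))\<^sup>2 + (cmod (B t))\<^sup>2)"
    if "t \<in> {0..2*pi}" for t
  proof -
    have "cmod (of_real (t - pi) * (A t * B t)) = \<bar>t - pi\<bar> * (cmod (A t) * cmod (B t))"
      by (simp add: norm_mult flip: of_real_diff)
    also have "\<dots> \<le> pi * (((cmod (A t))\<^sup>2 + (cmod (B t))\<^sup>2) / 2)"
      using that sum_squares_bound[of "cmod (A t)" "cmod (B t)"] by (intro mult_mono) auto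
    finally show ?thesis by simp
  qed
  have "cmod (2 * pi / \<i> * S)
      \<le> pi / 2 * (2 * pi * (\<Sum>i<N. (cmod (x i))\<^sup>2) + 2 * pi * (\<Sum>j<N. (cmod (y j))\<^sup>2))"
    unfolding integral_unique[OF I, symmetric] integral_unique[OF J, symmetric]
    by (rule integral_norm_bound_integral[OF has_integral_integrable[OF I]
        has_integral_integrable[OF J] bound])
  also have "cmod (2 * pi / \<i> * S) = 2 * pi * cmod S" by (simp add: norm_mult norm_divide)
  also have "pi / 2 * (2 * pi * (\<Sum>i<N. (cmod (x i))\<^sup>2) + 2 * pi * (\<Sum>j<N. (cmod (y j))\<^sup>2))
    = 2 * pi * (pi / 2 * ((\<Sum>i<N. (cmod (x i))\<^sup>2) + (\<Sum>j<N. (cmod (y j))\<^sup>2)))"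
    by (simp add: algebra_simps)
  finally show ?thesis using mult_le_cancel_left_pos[of "2*pi"] unfolding S_def by auto
qed

text \<open>Scaling both vectors to norm at most 1 turns the additive bound into a product.
  \<open>X\<close> and \<open>Y\<close> are mere upper bounds, so that full \<open>H2\<close> norms
  can be inserted for finite sections.\<close>

lemma hilbert_inequality:
  fixes x y :: "nat \<Rightarrow> complex"
  assumes x: "(\<Sum>i<N. (cmod (x i))\<^sup>2) \<le> X\<^sup>2" and y: "(\<Sum>j<N. (cmod (y j))\<^sup>2) \<le> Y\<^sup>2"
    and nonneg: "X \<ge> 0" "Y \<ge> 0"
  shows "cmod (\<Sum>i<N. \<Sum>j<N. x i * y j / (of_nat j - of_nat i)) \<le> pi * (X * Y)"
proof (cases "X = 0 \<or> Y = 0")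
  case True
  have "(\<Sum>i<N. (cmod (z i))\<^sup>2) \<le> 0 \<longleftrightarrow> (\<forall>i<N. z i = 0)" for z
    by (auto simp: sum_nonneg_eq_0_iff order_antisym_conv sum_nonneg)
  with True x y have "(\<forall>i<N. x i = 0) \<or> (\<forall>i<N. y i = 0)" by auto
  then have "(\<Sum>i<N. \<Sum>j<N. x i * y j / (of_nat j - of_nat i)) = 0"
    by (intro sum.neutral ballI) auto
  then show ?thesis using nonneg by simp
next
  case False
  then have pos: "X > 0" "Y > 0" using nonneg by auto
  let ?S = "\<Sum>i<N. \<Sum>j<N. x i * y j / (of_nat j - of_nat i)"
  have "(\<Sum>i<N. \<Sum>j<N. x i / X * (y j / Y) / (of_nat j - of_nat i)) = ?S / (X * Y)"
    unfolding sum_divide_distrib by (intro sum.cong refl) (simp add: field_simps)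
  moreover have "(\<Sum>i<N. (cmod (x i / X))\<^sup>2) \<le> 1"
    using x pos by (simp add: norm_divide power_divide flip: sum_divide_distrib)
  moreover have "(\<Sum>i<N. (cmod (y i / Y))\<^sup>2) \<le> 1"
    using y pos by (simp add: norm_divide power_divide flip: sum_divide_distrib)
  ultimately have "cmod (?S / (X * Y)) \<le> pi / 2 * (1 + 1)"
    using hilbert_inequality_sum[where N = N and x = "\<lambda>i. x i / X" and y = "\<lambda>j. y j / Y"]
    by (smt (verit) mult_left_mono pi_half_ge_zero)
  then show ?thesis using pos by (simp add: norm_divide norm_mult field_simps)
qed

section \<open>Dirichlet products and \<open>H2\<close> norms\<close>

lemma dmult_commute: "dmult f g = dmult g f"
proof
  fix n
  have "(\<Sum>d | d dvd n. f d * g (n div d)) = (\<Sum>d | d dvd n. g d * f (n div d))" if "n > 0"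
    using that by (intro sum.reindex_bij_witness[of _ "\<lambda>d. n div d" "\<lambda>d. n div d"])
      (auto elim!: dvdE)
  then show "dmult f g n = dmult g f n" by (auto simp: dmult_def)
qed

text \<open>\<open>ln\<close> is additive over each factorization \<open>n = d * (n div d)\<close>.
  The undifferentiated factor stands first in both terms, as in \<open>skew_reps\<close>.\<close>

lemma dderiv_dmult: "dderiv (dmult f g) n = dmult f (dderiv g) n + dmult g (dderiv f) n"
proof (cases "n = 0")
  case False
  have "- (complex_of_real (ln (real n)) * (f d * g (n div d)))
      = f d * dderiv g (n div d) + dderiv f d * g (n div d)" if "d dvd n" for d
    using that False by (auto elim!: dvdE simp: dderiv_def ln_mult algebra_simps)
  then have "dderiv (dmult f g) n = dmult f (dderiv g) n + dmult (dderiv f) g n"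
    using False by (simp add: dmult_def dderiv_def sum_distrib_left flip: sum.distrib sum_negf)
  then show ?thesis by (simp only: dmult_commute[of "dderiv f"])
qed (simp add: dmult_def dderiv_def)

lemma dmult_1: "dmult f g 1 = f 1 * g 1"
  by (simp add: dmult_def)

text \<open>The four divisors of \<open>p * q\<close> give four terms; \<open>f 1 = 0\<close>
  removes the one from the divisor 1.\<close>

lemma dmult_prime_mult:
  assumes p: "prime p" and q: "prime q" and "p \<noteq> q" and "f 1 = 0"
  shows "dmult f g (p * q) = f p * g q + f q * g p + f (p * q) * g 1"
proof -
  have "{d. d dvd p * q} = {1, p, q, p * q}"
  proof (intro equalityI subsetI)
    fix d assume "d \<in> {d. d dvd p * q}"
    then obtain u v where "d = u * v" "u dvd p" "v dvd q"
      using division_decomp by blast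
    moreover from this have "u = 1 \<or> u = p" "v = 1 \<or> v = q"
      using p q by (auto simp: prime_nat_iff)
    ultimately show "d \<in> {1, p, q, p * q}" by auto
  qed auto
  moreover have "p * q \<noteq> p" "p * q \<noteq> q" "p > 1" "q > 1"
    using prime_gt_1_nat[OF p] prime_gt_1_nat[OF q] by auto
  ultimately show ?thesis using assms by (simp add: dmult_def)
qed

lemma H2_norm_nonneg: "H2_norm f \<ge> 0" if "f \<in> H2"
  using that by (auto simp: H2_norm_def H2_def intro!: suminf_nonneg)

lemma sum_le_H2_norm:
  assumes "f \<in> H2" "inj_on p {..<N::nat}"
  shows "(\<Sum>i<N. (cmod (f (p i)))\<^sup>2) \<le> (H2_norm f)\<^sup>2"
proof -
  have s: "summable (\<lambda>n. (cmod (f n))\<^sup>2)" using assms by (simp add: H2_def)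
  have "(\<Sum>i<N. (cmod (f (p i)))\<^sup>2) = (\<Sum>n\<in>p ` {..<N}. (cmod (f n))\<^sup>2)"
    using assms by (simp add: sum.reindex)
  also have "\<dots> \<le> (\<Sum>n. (cmod (f n))\<^sup>2)"
    using s by (intro sum_le_suminf) auto
  also have "\<dots> = (H2_norm f)\<^sup>2"
    using s by (simp add: H2_norm_def suminf_nonneg)
  finally show ?thesis .
qed

section \<open>Inclusion of the weak product in the skew product\<close>

lemma rep_cost_nonneg: "set ps \<subseteq> H2_0 \<times> H2_0 \<Longrightarrow> rep_cost ps \<ge> 0"
  unfolding rep_cost_def by (rule sum_list_nonneg) (auto simp: H2_0_def H2_norm_nonneg)

lemma skew_norm_le: "ps \<in> skew_reps F \<Longrightarrow> skew_norm F \<le> rep_cost ps"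
  unfolding skew_norm_def
  by (rule cINF_lower) (auto intro!: bdd_belowI2[of _ 0] rep_cost_nonneg simp: skew_reps_def)

lemma H2_0_uminus: "f \<in> H2_0 \<Longrightarrow> (\<lambda>n. - f n) \<in> H2_0"
  by (simp add: H2_0_def H2_def)

lemma dmult_uminus: "dmult (\<lambda>n. - f n) g n = - dmult f g n"
  by (simp add: dmult_def sum_negf)

text \<open>Completions measure differences, and an infimum over representations is meaningful only
  if there is one; the minus sign goes into the first factors.\<close>

lemma weak_finite_diff:
  assumes "F \<in> weak_finite" "G \<in> weak_finite"
  shows "(\<lambda>n. F n - G n) \<in> weak_finite"
proof -
  obtain ps qs where ps: "ps \<in> weak_reps F" and qs: "qs \<in> weak_reps G"
    using assms by (auto simp: weak_finite_def)
  have neg: "(\<Sum>x\<leftarrow>xs. - h x) = - (\<Sum>x\<leftarrow>xs. h x)"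
    for xs :: "(dseries \<times> dseries) list" and h :: "dseries \<times> dseries \<Rightarrow> complex"
    by (induction xs) auto
  have "ps @ map (\<lambda>(f, g). (\<lambda>n. - f n, g)) qs \<in> weak_reps (\<lambda>n. F n - G n)"
    using ps qs by (auto simp: weak_reps_def o_def case_prod_unfold dmult_uminus H2_0_uminus neg)
  then show ?thesis by (auto simp: weak_finite_def)
qed

text \<open>By the product rule each pair yields \<open>f g' + g f'\<close>; the swapped copy of the
  list supplies the second terms.\<close>

lemma weak_reps_imp_skew_reps:
  assumes "ps \<in> weak_reps F"
  shows "ps @ map prod.swap ps \<in> skew_reps F"
proof -
  have F: "F = (\<lambda>n. \<Sum>(f, g)\<leftarrow>ps. dmult f g n)" and ps: "set ps \<subseteq> H2_0 \<times> H2_0"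
    using assms by (auto simp: weak_reps_def)
  have "dderiv F n = (\<Sum>(f, g)\<leftarrow>ps @ map prod.swap ps. dmult f (dderiv g) n)" for n
  proof -
    have "dderiv F n = (\<Sum>(f, g)\<leftarrow>ps. dderiv (dmult f g) n)"
      unfolding F dderiv_def
      by (simp add: case_prod_unfold flip: sum_list_const_mult uminus_sum_list_map[unfolded o_def])
    then show ?thesis
      by (simp add: dderiv_dmult case_prod_unfold sum_list_addf o_def)
  qed
  then show ?thesis using ps by (auto simp: skew_reps_def)
qed

lemma weak_finite_subset_skew_finite: "weak_finite \<subseteq> skew_finite"
proof
  fix F assume "F \<in> weak_finite"
  then obtain ps where ps: "ps \<in> weak_reps F" by (auto simp: weak_finite_def)
  then have "F 0 = 0"
    by (auto simp: weak_reps_def dmult_def case_prod_unfold)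
  moreover have "F 1 = (\<Sum>(f, g)\<leftarrow>ps. dmult f g 1)" using ps by (simp add: weak_reps_def)
  then have "F 1 = (\<Sum>_\<leftarrow>ps. 0)"
    using ps by (simp only:) (intro arg_cong[of _ _ sum_list] map_cong, auto simp: weak_reps_def dmult_1[simplified] H2_0_def)
  moreover have "skew_reps F \<noteq> {}" using weak_reps_imp_skew_reps[OF ps] by blast
  ultimately show "F \<in> skew_finite" by (simp add: skew_finite_def)
qed

lemma skew_norm_le_weak_norm:
  assumes "F \<in> weak_finite"
  shows "skew_norm F \<le> 2 * weak_norm F"
proof -
  \<comment> \<open>The factor 2 is the cost of the doubled list, as swapping keeps the cost of a
    pair. Dividing by it leaves a lower bound for an infimum.\<close>
  have "skew_norm F / 2 \<le> weak_norm F"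
    unfolding weak_norm_def
  proof (rule cINF_greatest)
    fix ps assume "ps \<in> weak_reps F"
    from skew_norm_le[OF weak_reps_imp_skew_reps[OF this]]
    show "skew_norm F / 2 \<le> rep_cost ps"
      by (simp add: rep_cost_def case_prod_unfold o_def mult.commute)
  qed (use assms in \<open>simp add: weak_finite_def\<close>)
  then show ?thesis by simp
qed

text \<open>The same Cauchy sequence serves for both norms, and the coefficientwise limit does not
  depend on the norm.\<close>

lemma weak_product_subset_skew_product: "weak_product \<subseteq> skew_product"
proof
  fix F assume "F \<in> weak_product"
  then obtain X where X: "\<And>j. X j \<in> weak_finite"
    and cauchy: "\<And>e. e > 0 \<Longrightarrow> \<exists>M. \<forall>i\<ge>M. \<forall>j\<ge>M. weak_norm (\<lambda>n. X i n - X j n) < e"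
    and lim: "\<And>n. (\<lambda>j. X j n) \<longlonglongrightarrow> F n"
    unfolding weak_product_def ds_completion_def by blast
  have "\<exists>M. \<forall>i\<ge>M. \<forall>j\<ge>M. skew_norm (\<lambda>n. X i n - X j n) < e" if "e > 0" for e
  proof -
    from that have "e / 2 > 0" by simp
    from cauchy[OF this] obtain M where M: "\<And>i j. i \<ge> M \<Longrightarrow> j \<ge> M \<Longrightarrow> weak_norm (\<lambda>n. X i n - X j n) < e / 2"
      by blast
    have "skew_norm (\<lambda>n. X i n - X j n) < e" if "i \<ge> M" "j \<ge> M" for i j
      using M[OF that] skew_norm_le_weak_norm[OF weak_finite_diff[OF X X], of i j] by linarith
    then show ?thesis by blast
  qed
  then show "F \<in> skew_product"
    unfolding skew_product_def ds_completion_def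
    using X weak_finite_subset_skew_finite lim by blast
qed

section \<open>Finite elements and primitives in the skew product\<close>

lemma skew_finite_subset_skew_product: "skew_finite \<subseteq> skew_product"
proof
  fix F assume F: "F \<in> skew_finite"
  \<comment> \<open>The constant sequence is Cauchy because the empty list represents 0 at cost
    0.\<close>
  have "skew_norm (\<lambda>n. F n - F n) \<le> rep_cost []"
    by (rule skew_norm_le) (auto simp: skew_reps_def dderiv_def)
  then have "skew_norm (\<lambda>n. F n - F n) \<le> 0" by (simp add: rep_cost_def)
  then show "F \<in> skew_product"
    unfolding skew_product_def ds_completion_def using F
    by (auto intro!: exI[of _ "\<lambda>_. F"] intro: le_less_trans)
qed

lemma skew_finite_primitive:
  assumes "f \<in> H2_0" "g \<in> H2_0"
  shows "(\<lambda>n. - dmult f (dderiv g) n / ln (real n)) \<in> skew_finite"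
proof -
  have "dderiv (\<lambda>n. - dmult f (dderiv g) n / ln (real n)) n = dmult f (dderiv g) n" for n
  \<comment> \<open>At these indices the product vanishes, by the convention at 0 and by
    \<open>f 1 = 0\<close>, so the division by \<open>ln 1 = 0\<close> does no harm.\<close>
  proof (cases "n = 0 \<or> n = 1")
    case True
    then show ?thesis
      using assms by (auto simp: dderiv_def dmult_def H2_0_def)
  next
    case False
    then have "ln (real n) \<noteq> 0" by (cases n) auto
    then show ?thesis by (simp add: dderiv_def)
  qed
  then have "[(f, g)] \<in> skew_reps (\<lambda>n. - dmult f (dderiv g) n / ln (real n))"
    using assms by (auto simp: skew_reps_def)
  then show ?thesis by (auto simp: skew_finite_def)
qed

section \<open>Boundedness of the Hilbert form on the weak product\<close>

text \<open>A finite section, hence continuous under coefficientwise limits, the convergence that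
  \<open>ds_completion\<close> gives to its elements. The bounds below are uniform in
  \<open>N\<close>.\<close>

definition hilbert_form :: "(nat \<Rightarrow> nat) \<Rightarrow> (nat \<Rightarrow> nat) \<Rightarrow> nat \<Rightarrow> dseries \<Rightarrow> complex" where
  "hilbert_form p q N F = (\<Sum>i<N. \<Sum>j<N. F (p i * q j) / (of_nat j - of_nat i))"

lemma hilbert_form_diff:
  "hilbert_form p q N (\<lambda>n. F n - G n) = hilbert_form p q N F - hilbert_form p q N G"
  by (simp add: hilbert_form_def diff_divide_distrib sum_subtractf)

lemma hilbert_form_sum_list:
  "hilbert_form p q N (\<lambda>n. \<Sum>x\<leftarrow>xs. h x n) = (\<Sum>x\<leftarrow>xs. hilbert_form p q N (h x))"
  by (induction xs) (simp_all add: hilbert_form_def add_divide_distrib sum.distrib)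

lemma norm_sum_list_le: "norm (\<Sum>x\<leftarrow>xs. h x) \<le> (\<Sum>x\<leftarrow>xs. norm (h x))"
  for h :: "'a \<Rightarrow> 'b::real_normed_vector"
  by (induction xs) (auto intro: norm_triangle_le)

locale disjoint_prime_families =
  fixes p q :: "nat \<Rightarrow> nat"
  assumes prime_p: "prime (p i)" and prime_q: "prime (q i)"
    and inj_p: "inj p" and inj_q: "inj q" and p_neq_q: "p i \<noteq> q j"
begin

text \<open>At \<open>p i * q j\<close> the product has the coefficient
  \<open>f (p i) * g (q j) + g (p i) * f (q j)\<close>: two rank-one matrices, each handled by
  Hilbert's inequality at cost \<open>pi\<close>.\<close>

lemma norm_hilbert_form_dmult_le:
  assumes f: "f \<in> H2_0" and g: "g \<in> H2_0"
  shows "cmod (hilbert_form p q N (dmult f g)) \<le> 2 * pi * (H2_norm f * H2_norm g)"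
proof -
  have H2: "f \<in> H2" "g \<in> H2" and at_1: "f 1 = 0" "g 1 = 0"
    using f g by (auto simp: H2_0_def)
  have "hilbert_form p q N (dmult f g)
      = (\<Sum>i<N. \<Sum>j<N. f (p i) * g (q j) / (of_nat j - of_nat i))
      + (\<Sum>i<N. \<Sum>j<N. g (p i) * f (q j) / (of_nat j - of_nat i))"
    using at_1
    by (simp add: hilbert_form_def dmult_prime_mult prime_p prime_q p_neq_q add_divide_distrib
        sum.distrib mult.commute)
  moreover have bound: "cmod (\<Sum>i<N. \<Sum>j<N. u (p i) * v (q j) / (of_nat j - of_nat i))
      \<le> pi * (H2_norm u * H2_norm v)" if "u \<in> H2" "v \<in> H2" for u v
    using that inj_p inj_q
    by (intro hilbert_inequality sum_le_H2_norm H2_norm_nonneg) (auto intro: inj_on_subset)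
  ultimately show ?thesis
    using norm_triangle_mono[OF bound[OF H2] bound[OF H2(2,1)]] by (simp add: mult.commute)
qed

lemma norm_hilbert_form_le_weak_norm:
  assumes "F \<in> weak_finite"
  shows "cmod (hilbert_form p q N F) \<le> 2 * pi * weak_norm F"
proof -
  have "cmod (hilbert_form p q N F) / (2 * pi) \<le> weak_norm F"
    unfolding weak_norm_def
  proof (rule cINF_greatest)
    fix ps assume ps: "ps \<in> weak_reps F"
    then have "F = (\<lambda>n. \<Sum>x\<leftarrow>ps. dmult (fst x) (snd x) n)"
      by (simp add: weak_reps_def case_prod_unfold)
    then have "cmod (hilbert_form p q N F)
        \<le> (\<Sum>x\<leftarrow>ps. cmod (hilbert_form p q N (dmult (fst x) (snd x))))"
      by (simp only: hilbert_form_sum_list norm_sum_list_le)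
    also have "\<dots> \<le> (\<Sum>x\<leftarrow>ps. 2 * pi * (H2_norm (fst x) * H2_norm (snd x)))"
      using ps by (intro sum_list_mono norm_hilbert_form_dmult_le) (auto simp: weak_reps_def)
    also have "\<dots> = 2 * pi * rep_cost ps"
      by (simp add: rep_cost_def case_prod_unfold sum_list_const_mult)
    finally show "cmod (hilbert_form p q N F) / (2 * pi) \<le> rep_cost ps"
      by (simp add: field_simps)
  qed (use assms in \<open>simp add: weak_finite_def\<close>)
  then show ?thesis by (simp add: field_simps)
qed

lemma hilbert_form_bounded_on_weak_product:
  assumes "F \<in> weak_product"
  shows "\<exists>C. \<forall>N. cmod (hilbert_form p q N F) \<le> C"
proof -
  obtain X where X: "\<And>j. X j \<in> weak_finite"
    and cauchy: "\<And>e. e > 0 \<Longrightarrow> \<exists>M. \<forall>i\<ge>M. \<forall>j\<ge>M. weak_norm (\<lambda>n. X i n - X j n) < e"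
    and lim: "\<And>n. (\<lambda>j. X j n) \<longlonglongrightarrow> F n"
    using assms unfolding weak_product_def ds_completion_def by blast
  obtain M where M: "\<And>i. i \<ge> M \<Longrightarrow> weak_norm (\<lambda>n. X i n - X M n) < 1"
    using cauchy[OF zero_less_one] by blast
  have "cmod (hilbert_form p q N F) \<le> 2 * pi * (1 + weak_norm (X M))" for N
  proof (rule LIMSEQ_le_const2)
    show "(\<lambda>i. cmod (hilbert_form p q N (X i))) \<longlonglongrightarrow> cmod (hilbert_form p q N F)"
      unfolding hilbert_form_def divide_inverse by (intro tendsto_intros lim)
    have "cmod (hilbert_form p q N (X i)) \<le> 2 * pi * (1 + weak_norm (X M))" if "i \<ge> M" for i
    proof -
      \<comment> \<open>The triangle inequality is applied to the form, so none is required for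
        \<open>weak_norm\<close>.\<close>
      have "cmod (hilbert_form p q N (X i))
          \<le> cmod (hilbert_form p q N (\<lambda>n. X i n - X M n)) + cmod (hilbert_form p q N (X M))"
        unfolding hilbert_form_diff using norm_triangle_sub[of "hilbert_form p q N (X i)"]
        by (simp add: add.commute)
      also have "\<dots> \<le> 2 * pi * weak_norm (\<lambda>n. X i n - X M n) + 2 * pi * weak_norm (X M)"
        by (intro add_mono norm_hilbert_form_le_weak_norm weak_finite_diff X)
      also have "\<dots> \<le> 2 * pi * 1 + 2 * pi * weak_norm (X M)"
        using M[OF that] by (intro add_mono mult_left_mono) auto
      finally show ?thesis by (simp add: distrib_left)
    qed
    then show "\<exists>K. \<forall>i\<ge>K. cmod (hilbert_form p q N (X i)) \<le> 2 * pi * (1 + weak_norm (X M))"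
      by blast
  qed
  then show ?thesis by blast
qed

end

section \<open>Lacunary primes and series supported on primes\<close>

text \<open>Exceeding the square means that logarithms at least double at each step.\<close>

lemma exists_lacunary_primes:
  "\<exists>P :: nat \<Rightarrow> nat. (\<forall>k. prime (P k)) \<and> (\<forall>k. (P k)\<^sup>2 < P (Suc k))"
proof -
  have "\<exists>P :: nat \<Rightarrow> nat. \<forall>k. prime (P k) \<and> (P k)\<^sup>2 < P (Suc k)"
  proof (rule dependent_nat_choice[where P = "\<lambda>_. prime" and Q = "\<lambda>_ x y. x\<^sup>2 < y"])
    show "\<exists>x::nat. prime x" using two_is_prime_nat by blast
    show "\<exists>y. prime y \<and> x\<^sup>2 < y" for x :: nat using bigger_prime by blast
  qed
  then show ?thesis by blast
qed

definition prime_series :: "(nat \<Rightarrow> nat) \<Rightarrow> (nat \<Rightarrow> real) \<Rightarrow> dseries" where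
  "prime_series p a n = (if n \<in> range p then of_real (a (inv p n)) else 0)"

lemma prime_series_apply: "inj p \<Longrightarrow> prime_series p a (p i) = of_real (a i)"
  by (simp add: prime_series_def)

lemma prime_series_in_H2_0:
  assumes "strict_mono p" "\<And>i. prime (p i)" "summable (\<lambda>i. (a i)\<^sup>2)"
  shows "prime_series p a \<in> H2_0"
proof -
  have "summable (\<lambda>i. (cmod (prime_series p a (p i)))\<^sup>2)"
    using assms by (simp add: prime_series_apply strict_mono_imp_inj_on)
  then have "summable (\<lambda>n. (cmod (prime_series p a n))\<^sup>2)"
    by (subst (asm) summable_mono_reindex[OF assms(1)]) (auto simp: prime_series_def)
  moreover have "0 \<notin> range p" "1 \<notin> range p"
    using assms(2) by (metis imageE not_prime_0, metis imageE not_prime_1)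
  ultimately show ?thesis by (simp add: H2_0_def H2_def prime_series_def)
qed

section \<open>A square summable sequence with divergent truncated Hilbert sum\<close>

text \<open>The squares telescope to a convergent series, while those weighted by \<open>1 + harm n\<close> are comparable
  to the increments of \<open>ln (1 + harm n)\<close> and so diverge.\<close>

definition log_weight :: "nat \<Rightarrow> real" where
  "log_weight n = sqrt (1 / (1 + harm n) - 1 / (1 + harm (Suc n)))"

lemma one_plus_harm_pos: "0 < 1 + (harm n :: real)"
  using harm_nonneg[of n, where ?'a = real] by simp

text \<open>The difference telescopes; the product form shows positivity and monotonicity, and that
  the weight is of order \<open>1 / (sqrt n * ln n)\<close>.\<close>

lemma log_weight_eq:
  "1 / (1 + harm n) - 1 / (1 + harm (Suc n))
    = 1 / (real (Suc n) * ((1 + harm n) * (1 + harm (Suc n))))"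
proof -
  have "h \<noteq> 0 \<Longrightarrow> k \<noteq> 0 \<Longrightarrow> 1 / h - 1 / k = (k - h) * (1 / (h * k))" for h k :: real
    by (simp add: field_simps)
  then have "1 / (1 + harm n) - 1 / (1 + harm (Suc n))
      = 1 / real (Suc n) * (1 / ((1 + harm n) * (1 + harm (Suc n))))"
    using one_plus_harm_pos[of n] one_plus_harm_pos[of "Suc n"]
    by (simp add: harm_Suc inverse_eq_divide del: of_nat_Suc)
  then show ?thesis by simp
qed

lemma log_weight_sq: "(log_weight n)\<^sup>2 = 1 / (1 + harm n) - 1 / (1 + harm (Suc n))"
  using one_plus_harm_pos[of n] one_plus_harm_pos[of "Suc n"]
  unfolding log_weight_def log_weight_eq by (intro real_sqrt_pow2) (simp add: less_imp_le)

lemma log_weight_nonneg: "log_weight n \<ge> 0"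
  using one_plus_harm_pos[of n] one_plus_harm_pos[of "Suc n"]
  unfolding log_weight_def log_weight_eq by (simp add: less_imp_le)

lemma log_weight_antimono:
  assumes "i \<le> j"
  shows "log_weight j \<le> log_weight i"
proof -
  have "harm i \<le> (harm j :: real)" "harm (Suc i) \<le> (harm (Suc j) :: real)"
    using assms by (auto intro!: harm_mono)
  then have "1 / (real (Suc j) * ((1 + harm j) * (1 + harm (Suc j))))
      \<le> 1 / (real (Suc i) * ((1 + harm i) * (1 + harm (Suc i))))"
    using assms one_plus_harm_pos[of i] one_plus_harm_pos[of "Suc i"]
    by (intro divide_left_mono mult_mono mult_pos_pos) auto
  then show ?thesis unfolding log_weight_def log_weight_eq by (rule real_sqrt_le_mono)
qed

lemma sum_log_weight_sq: "(\<Sum>n<N. (log_weight n)\<^sup>2) = 1 - 1 / (1 + harm N)"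
  by (induction N) (simp_all add: log_weight_sq harm_expand)

lemma summable_log_weight_sq: "summable (\<lambda>n. (log_weight n)\<^sup>2)"
  by (rule bounded_imp_summable[of _ 1])
    (auto simp: sum_log_weight_sq harm_nonneg simp flip: lessThan_Suc_atMost)

text \<open>With \<open>h\<close> and \<open>k\<close> as below, the squared weight times
  \<open>h\<close> is \<open>(k - h) / k\<close>. Now \<open>ln (k / h) \<le> (k - h) / h\<close>,
  and \<open>k \<le> 2 * h\<close> costs the factor 2. The subtracted square comes from
  \<open>harm n = h - 1\<close>.\<close>

lemma log_weight_sq_harm_ge:
  "(log_weight n)\<^sup>2 * harm n
    \<ge> (ln (1 + harm (Suc n)) - ln (1 + harm n)) / 2 - (log_weight n)\<^sup>2"
proof -
  define h k where "h = 1 + (harm n :: real)" and "k = 1 + (harm (Suc n) :: real)"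
  have h: "h \<ge> 1"
    by (simp add: h_def harm_nonneg)
  have "k - h = 1 / real (Suc n)" by (simp add: h_def k_def harm_Suc inverse_eq_divide)
  moreover have "0 \<le> 1 / real (Suc n)" "1 / real (Suc n) \<le> 1" by auto
  ultimately have kh: "h \<le> k" "k \<le> 2 * h" using h by linarith+
  have "ln k - ln h = ln (k / h)" using h kh by (simp add: ln_div)
  also have "\<dots> \<le> k / h - 1" using h kh by (intro ln_le_minus_one) auto
  also have "\<dots> = (k - h) * (1 / h)" using h by (simp add: field_simps)
  also have "\<dots> \<le> (k - h) * (2 / k)"
    using h kh by (intro mult_left_mono) (auto simp: field_simps)
  also have "\<dots> = 2 * ((k - h) / k)" by simp
  also have "(k - h) / k = (1 / h - 1 / k) * h" using h kh by (simp add: field_simps)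
  also have "1 / h - 1 / k = (log_weight n)\<^sup>2" by (simp only: log_weight_sq h_def k_def)
  finally have "(ln k - ln h) / 2 - (log_weight n)\<^sup>2 \<le> (log_weight n)\<^sup>2 * (h - 1)"
    by (simp add: right_diff_distrib)
  then show ?thesis by (simp add: h_def k_def)
qed

text \<open>The weights decrease, so \<open>log_weight i\<close> may be lowered to
  \<open>log_weight j\<close> for \<open>i < j\<close>; the kernel then sums to
  \<open>harm j\<close> in each row, and the resulting lower bounds telescope.\<close>

lemma sum_log_weight_hilbert_ge:
  "(\<Sum>j<N. \<Sum>i<j. log_weight i * log_weight j / (real j - real i)) \<ge> ln (1 + harm N) / 2 - 1"
proof -
  have row: "(\<Sum>i<j. log_weight i * log_weight j / (real j - real i)) \<ge> (log_weight j)\<^sup>2 * harm j" for j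
  proof -
    have "(harm j :: real) = (\<Sum>i<j. 1 / (real j - real i))"
      unfolding harm_def
      by (rule sum.reindex_bij_witness[of _ "\<lambda>i. j - i" "\<lambda>i. j - i"]) (auto simp: inverse_eq_divide of_nat_diff)
    then have "(log_weight j)\<^sup>2 * harm j = (\<Sum>i<j. log_weight j * log_weight j / (real j - real i))"
      by (simp add: sum_distrib_left power2_eq_square)
    also have "\<dots> \<le> (\<Sum>i<j. log_weight i * log_weight j / (real j - real i))"
      by (intro sum_mono divide_right_mono mult_right_mono log_weight_antimono log_weight_nonneg) auto
    finally show ?thesis .
  qed
  have "(\<Sum>j<N. (ln (1 + harm (Suc j)) - ln (1 + harm j)) / 2 - (log_weight j)\<^sup>2)
      = ln (1 + harm N) / 2 - 1 + 1 / (1 + harm N)"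
    by (induction N) (simp_all add: log_weight_sq diff_divide_distrib harm_expand(1))
  then have "ln (1 + harm N) / 2 - 1 \<le> (\<Sum>j<N. (ln (1 + harm (Suc j)) - ln (1 + harm j)) / 2 - (log_weight j)\<^sup>2)"
    using one_plus_harm_pos[of N] by simp
  also have "\<dots> \<le> (\<Sum>j<N. \<Sum>i<j. log_weight i * log_weight j / (real j - real i))"
    by (intro sum_mono order_trans[OF log_weight_sq_harm_ge row])
  finally show ?thesis .
qed

lemma sum_log_weight_hilbert_unbounded:
  "\<exists>N. (\<Sum>j<N. \<Sum>i<j. log_weight i * log_weight j / (real j - real i)) > C"
proof -
  have "filterlim (\<lambda>N. 1 + harm N :: real) at_top sequentially"
    by (rule filterlim_tendsto_add_at_top[OF tendsto_const harm_at_top])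
  from filterlim_compose[OF ln_at_top this]
  have "\<forall>\<^sub>F N in sequentially. ln (1 + harm N) > 2 * C + 2"
    by (simp add: filterlim_at_top_dense)
  then obtain N where "ln (1 + harm N) > 2 * C + 2"
    by (auto simp: eventually_sequentially)
  then show ?thesis using sum_log_weight_hilbert_ge[of N] by (intro exI[of _ N]) linarith
qed

text \<open>Symmetrizing the sum replaces \<open>L i j\<close> by half of its antisymmetric part, which has the sign
  of \<open>j - i\<close>; hence the cancellation in the Hilbert kernel is lost.\<close>

lemma sum_skewed_hilbert_ge:
  fixes L :: "nat \<Rightarrow> nat \<Rightarrow> real" and a :: "nat \<Rightarrow> real"
  assumes L: "\<And>i j. i < j \<Longrightarrow> L i j - L j i \<ge> d" and "d \<ge> 0" and a: "\<And>i. a i \<ge> 0"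
  shows "(\<Sum>i<N. \<Sum>j<N. a i * a j * L i j / (real j - real i))
    \<ge> d / 2 * (\<Sum>j<N. \<Sum>i<j. a i * a j / (real j - real i))"
proof -
  let ?T = "\<Sum>j<N. \<Sum>i<N. a i * a j * L i j / (real j - real i)"
  \<comment> \<open>Exchanging the names \<open>i\<close> and \<open>j\<close> reverses the sign of
    the denominator.\<close>
  have "?T = (\<Sum>j<N. \<Sum>i<N. a j * a i * L j i / (real i - real j))"
    by (rule sum.swap)
  also have "\<dots> = - (\<Sum>j<N. \<Sum>i<N. a i * a j * L j i / (real j - real i))"
    unfolding sum_negf[symmetric]
    by (intro sum.cong refl) (metis minus_diff_eq minus_divide_right mult.commute)
  finally have "2 * ?T = (\<Sum>j<N. \<Sum>i<N. a i * a j * ((L i j - L j i) / (real j - real i)))"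
    by (simp add: sum_subtractf diff_divide_distrib right_diff_distrib)
  also have "\<dots> \<ge> (\<Sum>j<N. \<Sum>i<j. a i * a j * (d / (real j - real i)))"
  proof (intro sum_mono order_trans[OF sum_mono sum_mono2])
    fix i j
    show "a i * a j * (d / (real j - real i)) \<le> a i * a j * ((L i j - L j i) / (real j - real i))"
      if "i \<in> {..<j}" using that a L by (intro mult_left_mono divide_right_mono) auto
    show "0 \<le> a i * a j * ((L i j - L j i) / (real j - real i))"
    proof -
      have "(L i j - L j i) / (real j - real i) \<ge> 0"
        using L[of i j] L[of j i] \<open>d \<ge> 0\<close>
        by (cases i j rule: linorder_cases) (auto intro!: divide_nonneg_nonneg divide_nonpos_nonpos)
      then show ?thesis using a by (intro mult_nonneg_nonneg)
    qed
  qed auto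
  also have "(\<Sum>j<N. \<Sum>i<j. a i * a j * (d / (real j - real i)))
      = d * (\<Sum>j<N. \<Sum>i<j. a i * a j / (real j - real i))"
    by (simp add: sum_distrib_left mult_ac)
  finally show ?thesis
    by (subst sum.swap) simp
qed

section \<open>The separating primitive\<close>

theorem theorem12:
  shows "weak_product \<subset> skew_product"
proof -
  obtain P :: "nat \<Rightarrow> nat" where prime: "\<And>k. prime (P k)" and step: "\<And>k. (P k)\<^sup>2 < P (Suc k)"
    using exists_lacunary_primes by blast
  have "P k < P (Suc k)" for k
    using step[of k] le_square[of "P k"] unfolding power2_eq_square by linarith
  then have mono: "strict_mono P" by (rule strict_mono_Suc_iff[THEN iffD2, rule_format])
  have ln_pos: "ln (real (P k)) > 0" for k
    using prime_gt_1_nat[OF prime[of k]] by simp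
  have ln_P: "2 * ln (real (P k)) \<le> ln (real (P l))" if "k < l" for k l
  proof -
    have "(P k)\<^sup>2 \<le> P l"
      using step[of k] strict_mono_less_eq[OF mono, of "Suc k" l] that by linarith
    then have "ln (real ((P k)\<^sup>2)) \<le> ln (real (P l))"
      using prime_gt_0_nat[OF prime] by (intro ln_mono) (auto simp del: of_nat_power)
    then show ?thesis using prime_gt_0_nat[OF prime[of k]] by (simp add: ln_realpow)
  qed
  define p q where "p i = P (2 * i)" and "q i = P (2 * i + 1)" for i
  have mono_p: "strict_mono p" and mono_q: "strict_mono q"
    using mono by (auto simp: p_def q_def strict_mono_def)
  have "p i \<noteq> q j" for i j
    using strict_mono_eq[OF mono, of "2 * i" "2 * j + 1"] by (auto simp: p_def q_def) presburger
  interpret disjoint_prime_families p q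
    by unfold_locales
      (use prime mono_p mono_q \<open>\<And>i j. p i \<noteq> q j\<close> in \<open>auto simp: p_def q_def strict_mono_imp_inj_on\<close>)
  define f g where "f = prime_series p log_weight" and "g = prime_series q log_weight"
  have f: "f \<in> H2_0" and g: "g \<in> H2_0"
    unfolding f_def g_def
    by (intro prime_series_in_H2_0 mono_p mono_q prime_p prime_q summable_log_weight_sq)+
  define F where "F = (\<lambda>n. - dmult f (dderiv g) n / ln (real n))"
  \<comment> \<open>The Schur multiplier: the numerator comes from differentiating \<open>g\<close>,
    the denominator \<open>ln (p i * q j)\<close> from taking the primitive.\<close>
  define L where "L i j = ln (real (q j)) / (ln (real (p i)) + ln (real (q j)))" for i j
  have F_pq: "F (p i * q j) = of_real (log_weight i * log_weight j * L i j)" for i j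
  proof -
    have "f (p i) = of_real (log_weight i)" "g (q j) = of_real (log_weight j)"
      by (simp_all add: f_def g_def prime_series_apply inj_p inj_q)
    moreover have "f 1 = 0" "dderiv g 1 = 0"
      using f by (simp_all add: H2_0_def dderiv_def)
    moreover have "f (q j) = 0"
      using p_neq_q by (metis f_def prime_series_def rangeE)
    moreover have "ln (real (p i * q j)) = ln (real (p i)) + ln (real (q j))"
      using prime_gt_0_nat[OF prime_p[of i]] prime_gt_0_nat[OF prime_q[of j]] by (simp add: ln_mult)
    ultimately show ?thesis
      by (simp add: F_def L_def dmult_prime_mult prime_p prime_q p_neq_q dderiv_def del: of_nat_mult)
  qed
  \<comment> \<open>For \<open>i < j\<close>, \<open>ln (q j)\<close> is at least twice
    \<open>ln (p i)\<close>, which gives 2/3, and \<open>ln (p j)\<close> is at least twice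
    \<open>ln (q i)\<close>, which gives 1/3.\<close>
  have L_diff: "L i j - L j i \<ge> 1 / 3" if "i < j" for i j
  proof -
    have "L i j \<ge> 2 / 3"
      using ln_P[of "2 * i" "2 * j + 1"] ln_pos[of "2 * i"] ln_pos[of "2 * j + 1"] that
      by (simp add: L_def p_def q_def field_simps)
    moreover have "L j i \<le> 1 / 3"
      using ln_P[of "2 * i + 1" "2 * j"] ln_pos[of "2 * i + 1"] ln_pos[of "2 * j"] that
      by (simp add: L_def p_def q_def field_simps)
    ultimately show ?thesis by simp
  qed
  have "F \<notin> weak_product"
  proof
    assume "F \<in> weak_product"
    then obtain C where C: "\<And>N. cmod (hilbert_form p q N F) \<le> C"
      using hilbert_form_bounded_on_weak_product by blast
    \<comment> \<open>The constant 6 inverts \<open>d / 2\<close> for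
      \<open>d = 1 / 3\<close>.\<close>
    obtain N where N: "(\<Sum>j<N. \<Sum>i<j. log_weight i * log_weight j / (real j - real i)) > 6 * C"
      using sum_log_weight_hilbert_unbounded by blast
    have "hilbert_form p q N F
        = of_real (\<Sum>i<N. \<Sum>j<N. log_weight i * log_weight j * L i j / (real j - real i))"
      by (simp add: hilbert_form_def F_pq)
    then have "(\<Sum>i<N. \<Sum>j<N. log_weight i * log_weight j * L i j / (real j - real i)) \<le> C"
      using C[of N] by (simp only: norm_of_real)
    moreover have "(\<Sum>i<N. \<Sum>j<N. log_weight i * log_weight j * L i j / (real j - real i))
        \<ge> 1 / 3 / 2 * (\<Sum>j<N. \<Sum>i<j. log_weight i * log_weight j / (real j - real i))"
      by (intro sum_skewed_hilbert_ge L_diff log_weight_nonneg) auto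
    ultimately show False using N by linarith
  qed
  moreover have "F \<in> skew_product"
    unfolding F_def using skew_finite_primitive[OF f g] skew_finite_subset_skew_product by blast
  ultimately show ?thesis using weak_product_subset_skew_product by blast
qed

end
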